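(* For every real $R$ with $1<R\le 3/2$ and every $\epsilon>0$, the competitive ratio of the general\&removable online knapsack problem with a buffer of capacity $R$ is at least $\frac{1}{R-1}-\epsilon$.
   Context: Online knapsack problem with a resource buffer: there is a knapsack of capacity $1$ and a buffer of capacity $R\ge 1$. Items $e_1,\dots,e_n$ arrive one by one; each item $e$ has size $0<s(e)\le 1$ and value $v(e)\ge 0$; $s(B),v(B)$ denote sums over a set $B$. A deterministic online algorithm maintains buffer contents $B_0=\emptyset,B_1,\dots,B_n$, with $B_i$ chosen after seeing only $e_1,\dots,e_i$, $B_i\subseteq B_{i-1}\cup\{e_i\}$ and $s(B_i)\le R$ (removable setting). $\mathrm{ALG}(I)=\max\{v(B)\mid B\subseteq B_n,\ s(B)\le 1\}$, $\mathrm{OPT}(I)=\max\{v(B)\mid B\subseteq\{e_1,\dots,e_n\},\ s(B)\le 1\}$. "General" means values are arbitrary. The competitive ratio of an algorithm is $\sup_I \mathrm{OPT}(I)/\mathrm{ALG}(I)$ (with $a/0=\infty$ for $a>0$), and the competitive ratio of the problem is the infimum of this over all deterministic online algorithms. *)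

theory Defs
  imports "HOL-Library.Extended_Real"
begin

text \<open>An item is a pair of its size and its value. An instance is the list of items in order of
  arrival. Sets of items are sets of positions in this list (counted from 0), so that different
  items may have equal size and value.\<close>

type_synonym item = "real \<times> real"
type_synonym inst = "item list"

abbreviation item_size :: "item \<Rightarrow> real" where "item_size \<equiv> fst"
abbreviation item_value :: "item \<Rightarrow> real" where "item_value \<equiv> snd"

definition valid_item :: "item \<Rightarrow> bool" where
  "valid_item e \<longleftrightarrow> 0 < item_size e \<and> item_size e \<le> 1 \<and> 0 \<le> item_value e"

definition valid_inst :: "inst \<Rightarrow> bool" where
  "valid_inst I \<longleftrightarrow> (\<forall>e \<in> set I. valid_item e)"

definition total_size :: "inst \<Rightarrow> nat set \<Rightarrow> real" where
  "total_size I B = (\<Sum>i\<in>B. item_size (I ! i))"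

definition total_value :: "inst \<Rightarrow> nat set \<Rightarrow> real" where
  "total_value I B = (\<Sum>i\<in>B. item_value (I ! i))"

text \<open>A deterministic online algorithm maps the sequence of items seen so far to the buffer
  contents: on an instance \<open>I\<close>, the buffer after \<open>i\<close> items is \<open>A (take i I)\<close>, which cannot depend
  on later items or on the length of \<open>I\<close>. The newly arrived item \<open>e\<close> has position \<open>length I\<close> in
  \<open>I @ [e]\<close>.\<close>

type_synonym algorithm = "inst \<Rightarrow> nat set"

definition online_algorithm :: "real \<Rightarrow> algorithm \<Rightarrow> bool" where
  "online_algorithm R A \<longleftrightarrow>
     A [] = {} \<and>
     (\<forall>I e. valid_inst (I @ [e]) \<longrightarrow>
        A (I @ [e]) \<subseteq> A I \<union> {length I} \<and> total_size (I @ [e]) (A (I @ [e])) \<le> R)"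

definition best_value :: "inst \<Rightarrow> nat set \<Rightarrow> real" where
  "best_value I S = Max {total_value I B | B. B \<subseteq> S \<and> total_size I B \<le> 1}"

definition ALG :: "algorithm \<Rightarrow> inst \<Rightarrow> real" where
  "ALG A I = best_value I (A I)"

definition OPT :: "inst \<Rightarrow> real" where
  "OPT I = best_value I {..<length I}"

text \<open>Division of extended reals satisfies \<open>a / 0 = \<infinity>\<close> for \<open>a > 0\<close>. It also has \<open>0 / 0 = 0\<close>, so
  instances with \<open>OPT I = 0\<close> do not contribute to the supremum.\<close>

definition algorithm_ratio :: "algorithm \<Rightarrow> ereal" where
  "algorithm_ratio A = (SUP I \<in> {I. valid_inst I}. ereal (OPT I) / ereal (ALG A I))"

definition competitive_ratio :: "real \<Rightarrow> ereal" where
  "competitive_ratio R = (INF A \<in> {A. online_algorithm R A}. algorithm_ratio A)"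

end

theory Submission
  imports Defs
begin

text \<open>The adversary first offers an item of size \<open>1\<close> and value \<open>1\<close>, then tiny items of size \<open>1/N\<close>
  whose density \<open>q^i\<close> grows slowly without bound. While the large item is in the buffer, the tiny
  items kept have total size at most \<open>R - 1\<close>. Hence, if the algorithm ever gives up the large item, it
  is left with a value of about \<open>R - 1\<close> times the current density, whereas the most recent \<open>N\<close>
  tiny items fill the knapsack at nearly the current density. If it never gives up the large item,
  that item becomes worthless compared with the tiny ones, and the same estimate applies.\<close>

section \<open>Packing values, buffer contents and extended real quotients\<close>

lemma best_value_le:
  assumes "finite S"
    and "\<And>B. B \<subseteq> S \<Longrightarrow> total_size I B \<le> 1 \<Longrightarrow> total_value I B \<le> c"
  shows "best_value I S \<le> c"
proof -
  have "finite {total_value I B | B. B \<subseteq> S \<and> total_size I B \<le> 1}"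
    using assms(1) by simp
  moreover have "total_size I {} \<le> 1"
    by (simp add: total_size_def)
  ultimately show ?thesis
    unfolding best_value_def using assms(2) by (subst Max_le_iff) auto
qed

lemma best_value_ge:
  assumes "finite S" "B \<subseteq> S" "total_size I B \<le> 1"
  shows "total_value I B \<le> best_value I S"
  unfolding best_value_def using assms by (intro Max_ge) auto

lemma online_algorithm_snocD:
  assumes "online_algorithm R A" "valid_inst (I @ [e])"
  shows "A (I @ [e]) \<subseteq> A I \<union> {length I}" "total_size (I @ [e]) (A (I @ [e])) \<le> R"
  using assms unfolding online_algorithm_def by blast+

lemma online_algorithm_subset:
  assumes "online_algorithm R A" "valid_inst I"
  shows "A I \<subseteq> {..<length I}"
  using assms(2)
proof (induction I rule: rev_induct)
  case Nil
  then show ?case using assms(1) by (simp add: online_algorithm_def)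
next
  case (snoc e I)
  then have "A I \<subseteq> {..<length I}"
    by (simp add: valid_inst_def)
  moreover have "A (I @ [e]) \<subseteq> A I \<union> {length I}"
    using assms(1) snoc.prems by (rule online_algorithm_snocD)
  ultimately show ?case by fastforce
qed

text \<open>Multiplying out lets one inequality also cover an algorithm of value 0, where the
  quotient is \<infinity> because \<open>0 < x\<close>.\<close>

lemma ereal_le_divide:
  assumes "0 < x" "0 \<le> y" "c * y \<le> x"
  shows "ereal c \<le> ereal x / ereal y"
  using assms by (cases "y = 0") (auto simp: field_simps)

section \<open>The adversarial instances and their optimum\<close>

text \<open>Position \<open>i\<close> doubles as the exponent of the density. With geometric growth,
  any \<open>N\<close> consecutive tiny items have densities within a factor \<open>q ^ N\<close> of
  each other, wherever the sequence stops.\<close>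

definition adv_item :: "nat \<Rightarrow> real \<Rightarrow> nat \<Rightarrow> item" where
  "adv_item N q i = (if i = 0 then (1, 1) else (1 / real N, q ^ i / real N))"

definition adv_inst :: "nat \<Rightarrow> real \<Rightarrow> nat \<Rightarrow> inst" where
  "adv_inst N q m = map (adv_item N q) [0..<m]"

lemma length_adv_inst [simp]: "length (adv_inst N q m) = m"
  by (simp add: adv_inst_def)

lemma adv_inst_Suc: "adv_inst N q (Suc m) = adv_inst N q m @ [adv_item N q m]"
  by (simp add: adv_inst_def)

lemma nth_adv_inst: "i < m \<Longrightarrow> adv_inst N q m ! i = adv_item N q i"
  by (simp add: adv_inst_def)

lemma valid_adv_inst:
  assumes "0 < N" "0 \<le> q"
  shows "valid_inst (adv_inst N q m)"
  using assms by (auto simp: valid_inst_def adv_inst_def valid_item_def adv_item_def)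

lemma total_size_adv:
  assumes "B \<subseteq> {..<m}"
  shows "total_size (adv_inst N q m) B = (if 0 \<in> B then 1 else 0) + real (card (B - {0})) / real N"
proof -
  have fin: "finite B" using assms finite_subset by blast
  have "total_size (adv_inst N q m) B = (\<Sum>i\<in>B. item_size (adv_item N q i))"
    unfolding total_size_def using assms by (intro sum.cong) (auto simp: nth_adv_inst subset_iff)
  also have "\<dots> = (if 0 \<in> B then 1 else 0) + (\<Sum>i\<in>B - {0}. item_size (adv_item N q i))"
    using fin by (cases "0 \<in> B") (auto simp: sum.remove[of B 0] adv_item_def[of _ _ 0])
  also have "(\<Sum>i\<in>B - {0}. item_size (adv_item N q i)) = (\<Sum>i\<in>B - {0}. 1 / real N)"
    by (intro sum.cong) (auto simp: adv_item_def)
  finally show ?thesis by simp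
qed

lemma total_value_adv:
  assumes "B \<subseteq> {..<m}" "0 \<notin> B"
  shows "total_value (adv_inst N q m) B = (\<Sum>i\<in>B. q ^ i) / real N"
proof -
  have "total_value (adv_inst N q m) B = (\<Sum>i\<in>B. q ^ i / real N)"
    unfolding total_value_def using assms
    by (intro sum.cong refl) (auto simp: nth_adv_inst subset_iff adv_item_def)
  then show ?thesis by (simp add: sum_divide_distrib)
qed

text \<open>Each tiny item before position \<open>m\<close> has density at most
  \<open>q ^ m\<close>, and \<open>c\<close> bounds the total size of \<open>B\<close>.\<close>

lemma total_value_adv_le:
  assumes "B \<subseteq> {..<m}" "0 \<notin> B" "0 < N" "1 \<le> q" "real (card B) \<le> c * real N"
  shows "total_value (adv_inst N q m) B \<le> c * q ^ m"
proof -
  have "(\<Sum>i\<in>B. q ^ i) \<le> real (card B) * q ^ m"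
    using assms by (intro sum_bounded_above power_increasing) auto
  also have "\<dots> \<le> c * real N * q ^ m"
    using assms by (intro mult_right_mono) auto
  finally show ?thesis
    using assms by (simp add: total_value_adv field_simps)
qed

text \<open>Early on, the large item alone is good enough, since \<open>q ^ m\<close> has not yet
  passed \<open>q ^ N\<close>. Later, the last \<open>N\<close> tiny items fill the knapsack at
  density at least \<open>q ^ (m - N)\<close>.\<close>

lemma OPT_adv_ge:
  assumes "0 < N" "1 \<le> q" "0 < m"
  shows "q ^ m \<le> q ^ N * OPT (adv_inst N q m)"
proof (cases "m \<le> N")
  case True
  have "total_value (adv_inst N q m) {0} \<le> OPT (adv_inst N q m)"
    unfolding OPT_def using assms by (intro best_value_ge) (auto simp: total_size_adv)
  moreover have "total_value (adv_inst N q m) {0} = 1"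
    using assms by (simp add: total_value_def nth_adv_inst adv_item_def)
  ultimately have "q ^ N * 1 \<le> q ^ N * OPT (adv_inst N q m)"
    using assms by (intro mult_left_mono) auto
  then show ?thesis
    using power_increasing[OF True assms(2)] by simp
next
  case False
  \<comment> \<open>As \<open>N < m\<close>, this block starts at position 1 or later and so misses
    the large item; its total size is exactly 1.\<close>
  define B where "B = {m - N..<m}"
  have B: "B \<subseteq> {..<m}" "0 \<notin> B" "card B = N"
    using False by (auto simp: B_def)
  have "real (card B) * q ^ (m - N) \<le> (\<Sum>i\<in>B. q ^ i)"
    using assms by (intro sum_bounded_below power_increasing) (auto simp: B_def)
  then have "q ^ (m - N) \<le> total_value (adv_inst N q m) B"
    using B assms by (simp add: total_value_adv field_simps)
  also have "\<dots> \<le> OPT (adv_inst N q m)"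
    unfolding OPT_def using B assms by (intro best_value_ge) (auto simp: total_size_adv)
  finally have "q ^ N * q ^ (m - N) \<le> q ^ N * OPT (adv_inst N q m)"
    using assms by (intro mult_left_mono) auto
  then show ?thesis
    using False by (simp flip: power_add)
qed

section \<open>Upper bounds on what the algorithm can pack\<close>

text \<open>Discarded items never return, so right after the drop the buffer holds at most the tiny
  items that had shared it with the large one, plus the arriving item; the latter accounts for the
  term \<open>1 / real N\<close>. The case \<open>m = 0\<close> is rejection of the large item on
  arrival.\<close>

lemma ALG_adv_le_dropped:
  assumes alg: "online_algorithm (1 + r) A" and "0 < N" "1 \<le> q" "0 < r"
    and kept: "m = 0 \<or> 0 \<in> A (adv_inst N q m)"
    and dropped: "0 \<notin> A (adv_inst N q (Suc m))"
  shows "ALG A (adv_inst N q (Suc m)) \<le> (r + 1 / real N) * q ^ Suc m"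
proof -
  let ?S = "A (adv_inst N q m)" and ?T = "A (adv_inst N q (Suc m))"
  have valid: "valid_inst (adv_inst N q k)" for k
    using assms by (simp add: valid_adv_inst)
  have S: "?S \<subseteq> {..<m}" and T: "?T \<subseteq> {..<Suc m}"
    using online_algorithm_subset[OF alg valid[of m]]
      online_algorithm_subset[OF alg valid[of "Suc m"]] by simp_all
  have "?T \<subseteq> ?S \<union> {m}"
    using online_algorithm_snocD(1)[OF alg] valid[of "Suc m"]
    unfolding adv_inst_Suc by fastforce
  then have sub: "?T \<subseteq> insert m (?S - {0})"
    using dropped by auto
  have fin: "finite ?S" "finite ?T"
    using S T finite_subset by blast+
  \<comment> \<open>The large item takes 1 of the capacity \<open>1 + r\<close>; for
    \<open>m = 0\<close> the buffer is still empty.\<close>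
  have "real (card (?S - {0})) \<le> r * real N"
  proof (cases m)
    case 0
    then show ?thesis using S assms by simp
  next
    case (Suc k)
    then have "total_size (adv_inst N q m) ?S \<le> 1 + r"
      using online_algorithm_snocD(2)[OF alg] valid[of m] unfolding Suc adv_inst_Suc by blast
    then show ?thesis
      using kept Suc S assms by (simp add: total_size_adv field_simps)
  qed
  moreover have "card ?T \<le> Suc (card (?S - {0}))"
    using card_mono[OF _ sub] fin by (auto simp: card_insert_if split: if_splits)
  ultimately have "real (card ?T) \<le> r * real N + 1"
    by linarith
  then have card_T: "real (card ?T) \<le> (r + 1 / real N) * real N"
    using assms(2) by (simp add: distrib_right)
  show ?thesis
    unfolding ALG_def
  proof (rule best_value_le)
    fix B assume B: "B \<subseteq> ?T"
    have "real (card B) \<le> (r + 1 / real N) * real N"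
      using card_mono[OF fin(2) B] card_T by linarith
    then show "total_value (adv_inst N q (Suc m)) B \<le> (r + 1 / real N) * q ^ Suc m"
      using B T dropped assms by (intro total_value_adv_le) auto
  qed (fact fin)
qed

text \<open>A packing is either the large item alone, whose value 1 is covered by
  \<open>large\<close>, or consists of tiny items that share the buffer with it and hence have total
  size at most \<open>r\<close>.\<close>

lemma ALG_adv_le_kept:
  assumes alg: "online_algorithm (1 + r) A" and "0 < N" "1 \<le> q" "0 < r"
    and kept: "0 \<in> A (adv_inst N q m)" and large: "1 \<le> r * q ^ m"
  shows "ALG A (adv_inst N q m) \<le> (r + 1 / real N) * q ^ m"
proof -
  let ?S = "A (adv_inst N q m)"
  have valid: "valid_inst (adv_inst N q m)"
    using assms by (simp add: valid_adv_inst)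
  have S: "?S \<subseteq> {..<m}"
    using online_algorithm_subset[OF alg valid] by simp
  then have fin: "finite ?S"
    using finite_subset by blast
  obtain k where k: "m = Suc k"
    using kept S by (cases m) auto
  have "total_size (adv_inst N q m) ?S \<le> 1 + r"
    using online_algorithm_snocD(2)[OF alg] valid unfolding k adv_inst_Suc by blast
  then have card_S: "real (card (?S - {0})) \<le> r * real N"
    using kept S assms by (simp add: total_size_adv field_simps)
  \<comment> \<open>The bound \<open>r * q ^ m\<close> obtained here is weakened to the form of the
    dropped case.\<close>
  have le: "r * q ^ m \<le> (r + 1 / real N) * q ^ m"
    using assms by (intro mult_right_mono) auto
  show ?thesis
    unfolding ALG_def
  proof (rule best_value_le)
    fix B assume B: "B \<subseteq> ?S" and size: "total_size (adv_inst N q m) B \<le> 1"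
    have Bm: "B \<subseteq> {..<m}" and finB: "finite B"
      using B S fin finite_subset by blast+
    have "total_value (adv_inst N q m) B \<le> r * q ^ m"
    proof (cases "0 \<in> B")
      case True
      \<comment> \<open>The large item fills the knapsack, leaving no room for a tiny one.\<close>
      then have "real (card (B - {0})) / real N \<le> 0"
        using size Bm by (simp add: total_size_adv)
      then have "B - {0} = {}"
        using assms(2) finB by (simp add: divide_le_0_iff card_eq_0_iff del: Diff_eq_empty_iff)
      then have "B = {0}"
        using True by auto
      then show ?thesis
        using large k by (simp add: total_value_def nth_adv_inst adv_item_def)
    next
      case False
      have "card B \<le> card (?S - {0})"
        using False B fin by (intro card_mono) auto
      then have "real (card B) \<le> r * real N"
        using card_S by linarith
      then show ?thesis
        using False Bm assms by (intro total_value_adv_le) auto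
    qed
    then show "total_value (adv_inst N q m) B \<le> (r + 1 / real N) * q ^ m"
      using le by linarith
  qed (fact fin)
qed

lemma ex_adv_inst_ALG_le:
  assumes alg: "online_algorithm (1 + r) A" and "0 < N" "1 < q" "0 < r"
  obtains m where "0 < m" "ALG A (adv_inst N q m) \<le> (r + 1 / real N) * q ^ m"
proof (cases "\<exists>m. 0 \<notin> A (adv_inst N q (Suc m))")
  case True
  \<comment> \<open>At the first absence, minimality puts the large item in the buffer one step
    earlier, unless it was never accepted.\<close>
  define m where "m = (LEAST m. 0 \<notin> A (adv_inst N q (Suc m)))"
  have "0 \<notin> A (adv_inst N q (Suc m))"
    unfolding m_def using True by (rule LeastI_ex)
  moreover have "m = 0 \<or> 0 \<in> A (adv_inst N q m)"
    using not_less_Least[of "m - 1" "\<lambda>m. 0 \<notin> A (adv_inst N q (Suc m))"]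
    by (cases m) (auto simp flip: m_def)
  ultimately show ?thesis
    using that[of "Suc m"] ALG_adv_le_dropped[OF alg, of N q m] assms by simp
next
  case False
  \<comment> \<open>Since \<open>1 < q\<close>, the density eventually exceeds \<open>1 / r\<close>,
    which makes the large item cheap enough for the kept case.\<close>
  obtain m where "1 / r < q ^ m"
    using real_arch_pow assms(3) by blast
  also have "\<dots> \<le> q ^ Suc m"
    using assms by (intro power_increasing) auto
  finally have "1 \<le> r * q ^ Suc m"
    using assms by (simp add: field_simps)
  then show ?thesis
    using that[of "Suc m"] ALG_adv_le_kept[OF alg, of N q "Suc m"] False assms by simp
qed

text \<open>Both estimates are relative to the current density \<open>q ^ m\<close>, which cancels:
  the bound does not depend on when the adversary stops.\<close>

lemma algorithm_ratio_ge:
  assumes alg: "online_algorithm (1 + r) A" and "0 < N" "1 < q" "0 < r"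
  shows "ereal (1 / ((r + 1 / real N) * q ^ N)) \<le> algorithm_ratio A"
proof -
  obtain m where m: "0 < m" "ALG A (adv_inst N q m) \<le> (r + 1 / real N) * q ^ m"
    using ex_adv_inst_ALG_le[OF assms] by blast
  let ?I = "adv_inst N q m"
  have valid: "valid_inst ?I"
    using assms by (simp add: valid_adv_inst)
  have opt: "q ^ m \<le> q ^ N * OPT ?I"
    using assms m by (intro OPT_adv_ge) auto
  have "0 < q ^ N * OPT ?I"
    using opt assms by (smt (verit) zero_less_power)
  then have opt_pos: "0 < OPT ?I"
    using assms by (simp add: zero_less_mult_iff)
  have "finite (A ?I)"
    using online_algorithm_subset[OF alg valid] finite_subset by blast
  then have "total_value ?I {} \<le> ALG A ?I"
    unfolding ALG_def by (intro best_value_ge) (auto simp: total_size_def)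
  then have alg_nonneg: "0 \<le> ALG A ?I"
    by (simp add: total_value_def)
  have pos: "0 < r + 1 / real N"
    using assms by (simp add: add_pos_nonneg)
  have "ALG A ?I \<le> (r + 1 / real N) * (q ^ N * OPT ?I)"
    using m(2) mult_left_mono[OF opt, of "r + 1 / real N"] pos by linarith
  moreover have "0 < (r + 1 / real N) * q ^ N"
    using pos assms by simp
  ultimately have "1 / ((r + 1 / real N) * q ^ N) * ALG A ?I \<le> OPT ?I"
    by (simp add: pos_divide_le_eq mult_ac)
  then have "ereal (1 / ((r + 1 / real N) * q ^ N)) \<le> ereal (OPT ?I) / ereal (ALG A ?I)"
    using opt_pos alg_nonneg by (intro ereal_le_divide)
  also have "\<dots> \<le> algorithm_ratio A"
    unfolding algorithm_ratio_def using valid by (intro SUP_upper) simp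
  finally show ?thesis .
qed

theorem theorem6:
  fixes R \<epsilon> :: real
  assumes "1 < R" and "R \<le> 3/2" and "\<epsilon> > 0"
  shows "competitive_ratio R \<ge> ereal (1 / (R - 1) - \<epsilon>)"
proof -
  define r where "r = R - 1"
  have r: "0 < r" "R = 1 + r"
    using assms(1) by (auto simp: r_def)
  \<comment> \<open>The factor \<open>1 + 1 / real N\<close> stands for \<open>q ^ N\<close>, with
    \<open>q\<close> chosen below; both error terms vanish in the limit.\<close>
  have "(\<lambda>N. 1 / ((r + 1 / real N) * (1 + 1 / real N))) \<longlonglongrightarrow> 1 / ((r + 0) * (1 + 0))"
    using r by (intro tendsto_intros lim_1_over_n) auto
  then have "\<forall>\<^sub>F N in sequentially. 1 / r - \<epsilon> < 1 / ((r + 1 / real N) * (1 + 1 / real N))"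
    using assms(3) by (intro order_tendstoD(1)) auto
  moreover have "\<forall>\<^sub>F N in sequentially. (0::nat) < N"
    by (rule eventually_gt_at_top)
  ultimately have "\<forall>\<^sub>F N in sequentially.
      0 < N \<and> 1 / r - \<epsilon> < 1 / ((r + 1 / real N) * (1 + 1 / real N))"
    by eventually_elim simp
  then obtain N :: nat where N: "0 < N" "1 / r - \<epsilon> < 1 / ((r + 1 / real N) * (1 + 1 / real N))"
    using eventually_happens'[OF sequentially_bot] by blast
  \<comment> \<open>The root keeps \<open>1 < q\<close>, so densities are unbounded, while the loss
    over \<open>N\<close> steps is only \<open>1 + 1 / real N\<close>.\<close>
  define q where "q = root N (1 + 1 / real N)"
  have q: "1 < q" "q ^ N = 1 + 1 / real N"
    using N(1) by (auto simp: q_def real_root_pow_pos2 add_nonneg_nonneg)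
  have "ereal (1 / r - \<epsilon>) \<le> algorithm_ratio A" if "online_algorithm R A" for A
  proof -
    have "ereal (1 / r - \<epsilon>) \<le> ereal (1 / ((r + 1 / real N) * q ^ N))"
      using N q by simp
    also have "\<dots> \<le> algorithm_ratio A"
      using that r N q by (intro algorithm_ratio_ge) auto
    finally show ?thesis .
  qed
  then show ?thesis
    unfolding competitive_ratio_def r_def[symmetric] by (intro INF_greatest) auto
qed

end
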